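(* Let $\alpha\in\mathbb{R}$ with $|\alpha|>1$, and let $f$ be a Bohr-almost periodic function on $\mathbb{R}$. Then for Lebesgue-almost every $x\in\mathbb{R}$, \[ \lim_{N\to\infty}\frac{1}{N}\sum_{n=0}^{N-1} f(\alpha^n x) = M(f). \]
   Context: A continuous function $f:\mathbb{R}\to\mathbb{C}$ is Bohr-almost periodic if for every $\varepsilon>0$ the set $\{t\in\mathbb{R} : \sup_{x\in\mathbb{R}}|f(x)-f(x-t)|<\varepsilon\}$ is relatively dense in $\mathbb{R}$ (equivalently, $f$ is a uniform limit on $\mathbb{R}$ of trigonometric polynomials $\sum_\ell c_\ell e^{2\pi i k_\ell x}$, $k_\ell\in\mathbb{R}$). Its mean $M(f)=\lim_{T\to\infty}\frac{1}{2T}\int_{a-T}^{a+T}f(x)\,\mathrm{d}x$ exists and is independent of $a\in\mathbb{R}$. *)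

theory Defs
  imports "HOL-Analysis.Analysis"
begin

definition relatively_dense :: "real set \<Rightarrow> bool" where
  "relatively_dense S \<longleftrightarrow> (\<exists>L>0. \<forall>a. S \<inter> {a..a + L} \<noteq> {})"

(* The supremum is taken in the extended reals, because on type real it is
   unspecified when the difference is unbounded. *)
definition bohr_almost_periodic :: "(real \<Rightarrow> complex) \<Rightarrow> bool" where
  "bohr_almost_periodic f \<longleftrightarrow>
     continuous_on UNIV f \<and>
     (\<forall>\<epsilon>::real. \<epsilon> > 0 \<longrightarrow>
        relatively_dense {t. (SUP x. ereal (cmod (f x - f (x - t)))) < ereal \<epsilon>})"

(* One and the same limit is required for every centre a. *)
definition bohr_mean :: "(real \<Rightarrow> complex) \<Rightarrow> complex" where
  "bohr_mean f =
     (THE m. \<forall>a. ((\<lambda>T. (1 / (2 * T)) *\<^sub>R integral {a - T..a + T} f) \<longlongrightarrow> m) at_top)"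

end

theory Submission
  imports Defs "HOL-Library.Discrete_Functions"
begin

text \<open>
  No approximation by trigonometric polynomials is needed. The means of \<open>f\<close> over windows
  \<open>[x, x + L]\<close> converge to \<open>M(f)\<close> uniformly in \<open>x\<close>, and \<open>f\<close> is bounded and uniformly continuous.
  Hence, up to a uniformly small error, \<open>f - M(f)\<close> equals \<open>h = f\<^sub>d - f\<^sub>L\<close>, where \<open>f\<^sub>T(x)\<close> is the mean of
  \<open>f\<close> over \<open>[x, x + T]\<close>, with \<open>d\<close> small and \<open>L\<close> large. This \<open>h\<close> is bounded, and so are its derivative and
  its antiderivative, so integration by parts shows that the correlation of \<open>h(\<alpha>\<^sup>m x)\<close> and
  \<open>h(\<alpha>\<^sup>n x)\<close> over \<open>[-R, R]\<close> decays like \<open>|\<alpha>|\<close> to the power \<open>-|n - m|\<close>. The second moment of the \<open>N\<close>-th sum is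
  therefore \<open>O(N)\<close>, so the averages tend to \<open>0\<close> almost everywhere along the squares, and
  boundedness of \<open>h\<close> fills the gaps.
\<close>


section \<open>Almost everywhere convergence from second moments\<close>

text \<open>Past the largest square k^2 up to n there are at most 2k further steps, which move
  \<open>s\<close> by at most 2kB. This is negligible against k^2.\<close>

lemma averages_tendsto_zero_along_squares:
  fixes s :: "nat \<Rightarrow> real"
  assumes step: "\<And>n. \<bar>s (Suc n) - s n\<bar> \<le> B"
    and squares: "(\<lambda>k. s (k\<^sup>2) / real (k\<^sup>2)) \<longlonglongrightarrow> 0"
  shows "(\<lambda>n. s n / real n) \<longlonglongrightarrow> 0"
proof -
  have B0: "0 \<le> B"
    using step[of 0] by linarith
  have gap: "\<bar>s (m + j) - s m\<bar> \<le> B * real j" for m j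
  proof (induction j)
    case (Suc j)
    then show ?case
      using step[of "m + j"] by (simp add: algebra_simps)
  qed simp
  \<comment> \<open>Majorant for all n between k^2 and (k+1)^2: the value at the square plus the
    drift 2kB divided by k^2.\<close>
  define g where "g k = \<bar>s (k\<^sup>2) / real (k\<^sup>2)\<bar> + 2 * B / real k" for k
  have "(\<lambda>k. 2 * B / real k) \<longlonglongrightarrow> 0"
    by (rule lim_const_over_n)
  then have g0: "g \<longlonglongrightarrow> 0"
    unfolding g_def using tendsto_add[OF tendsto_rabs_zero[OF squares]] by fastforce
  have "filterlim floor_sqrt at_top sequentially"
    unfolding filterlim_at_top eventually_sequentially by (meson le_floor_sqrtI order_trans)
  then have "(\<lambda>n. g (floor_sqrt n)) \<longlonglongrightarrow> 0"
    by (rule filterlim_compose[OF g0])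
  moreover have "norm (s n / real n) \<le> g (floor_sqrt n)" for n
  proof (cases "n = 0")
    case False
    define k where "k = floor_sqrt n"
    have k: "0 < k" "k\<^sup>2 \<le> n" "n - k\<^sup>2 \<le> 2 * k"
      using False Suc_floor_sqrt_power2_gt[of n] floor_sqrt_power2_le[of n]
      by (auto simp: k_def power2_eq_square)
    have "\<bar>s n - s (k\<^sup>2)\<bar> \<le> B * real (n - k\<^sup>2)"
      using gap[of "k\<^sup>2" "n - k\<^sup>2"] k by simp
    also have "\<dots> \<le> B * (2 * real k)"
      using B0 k by (intro mult_left_mono) linarith+
    finally have "\<bar>s n\<bar> \<le> \<bar>s (k\<^sup>2)\<bar> + B * (2 * real k)"
      by linarith
    then have "\<bar>s n\<bar> / real n \<le> (\<bar>s (k\<^sup>2)\<bar> + B * (2 * real k)) / real (k\<^sup>2)"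
      using k B0 by (intro frac_le) (auto simp del: of_nat_power)
    also have "\<dots> = g k"
      using k by (simp add: g_def field_simps power2_eq_square)
    finally show ?thesis
      by (simp add: k_def)
  qed (simp add: g_def)
  ultimately show ?thesis
    by (rule Lim_null_comparison[OF always_eventually, rotated, rule_format])
qed

text \<open>By monotone convergence the series of the \<open>g k\<close> has a finite integral over
  the interval. It therefore converges almost everywhere there, and its terms tend to 0.\<close>

lemma AE_tendsto_zero_of_summable_integrals:
  fixes g :: "nat \<Rightarrow> real \<Rightarrow> real"
  assumes cont: "\<And>k. continuous_on UNIV (g k)"
    and nonneg: "\<And>k x. 0 \<le> g k x"
    and bound: "\<And>k. integral {a..b} (g k) \<le> c k"
    and "summable c"
  shows "AE x in lborel. x \<in> {a..b} \<longrightarrow> (\<lambda>k. g k x) \<longlonglongrightarrow> 0"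
proof -
  have [measurable]: "g k \<in> borel_measurable borel" for k
    using cont by (rule borel_measurable_continuous_onI)
  have int: "g k integrable_on {a..b}" for k
    using cont continuous_on_subset by (blast intro: integrable_continuous_real)
  have c0: "0 \<le> c k" for k
    using bound[of k] integral_nonneg[OF int] nonneg by (meson order_trans)
  have "(\<integral>\<^sup>+x. ennreal (g k x) * indicator {a..b} x \<partial>lborel) \<le> ennreal (c k)" for k
    using nn_integral_has_integral_lebesgue'[OF nonneg integrable_integral[OF int]]
    by (simp add: bound ennreal_leI)
  then have "(\<integral>\<^sup>+x. (\<Sum>k. ennreal (g k x) * indicator {a..b} x) \<partial>lborel) \<le> (\<Sum>k. ennreal (c k))"
    by (subst nn_integral_suminf) (auto intro!: suminf_le)
  also have "\<dots> = ennreal (suminf c)"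
    using c0 \<open>summable c\<close> by (rule suminf_ennreal2)
  finally have "(\<integral>\<^sup>+x. (\<Sum>k. ennreal (g k x) * indicator {a..b} x) \<partial>lborel) \<noteq> \<infinity>"
    by (auto simp: top_unique)
  then have "AE x in lborel. (\<Sum>k. ennreal (g k x) * indicator {a..b} x) \<noteq> \<infinity>"
    by (intro nn_integral_PInf_AE) auto
  then show ?thesis
  proof eventually_elim
    case (elim x)
    show ?case
    proof
      assume "x \<in> {a..b}"
      then have "(\<Sum>k. ennreal (g k x)) \<noteq> top"
        using elim by (simp add: infinity_ennreal_def)
      then have "summable (\<lambda>k. g k x)"
        using nonneg by (intro summable_suminf_not_top)
      then show "(\<lambda>k. g k x) \<longlonglongrightarrow> 0"
        by (rule summable_LIMSEQ_zero)
    qed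
  qed
qed

text \<open>The mean square of S_N / N on [-R, R] is O(1/N), which is summable along N = k^2. The
  constant may depend on \<open>R\<close>, since natural values of \<open>R\<close> exhaust the line
  with countably many null sets.\<close>

lemma AE_averages_tendsto_zero:
  fixes S :: "nat \<Rightarrow> real \<Rightarrow> real"
  assumes cont: "\<And>N. continuous_on UNIV (S N)"
    and step: "\<And>N x. \<bar>S (Suc N) x - S N x\<bar> \<le> B"
    and second_moment: "\<And>R. 0 \<le> R \<Longrightarrow> \<exists>K. \<forall>N. integral {-R..R} (\<lambda>x. (S N x)\<^sup>2) \<le> K * real N"
  shows "AE x in lborel. (\<lambda>N. S N x / real N) \<longlonglongrightarrow> 0"
proof -
  have "AE x in lborel. x \<in> {-real R..real R} \<longrightarrow> (\<lambda>k. (S (k\<^sup>2) x / real (k\<^sup>2))\<^sup>2) \<longlonglongrightarrow> 0" for R :: nat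
  proof -
    obtain K where K: "\<And>N. integral {-real R..real R} (\<lambda>x. (S N x)\<^sup>2) \<le> K * real N"
      using second_moment[of "real R"] by auto
    show ?thesis
    proof (rule AE_tendsto_zero_of_summable_integrals)
      show "continuous_on UNIV (\<lambda>x. (S (k\<^sup>2) x / real (k\<^sup>2))\<^sup>2)" for k
        unfolding divide_inverse by (intro continuous_intros cont)
      show "integral {-real R..real R} (\<lambda>x. (S (k\<^sup>2) x / real (k\<^sup>2))\<^sup>2) \<le> K * (1 / real k ^ 2)" for k
      proof -
        have "integral {-real R..real R} (\<lambda>x. (S (k\<^sup>2) x / real (k\<^sup>2))\<^sup>2)
            = integral {-real R..real R} (\<lambda>x. (S (k\<^sup>2) x)\<^sup>2) / (real (k\<^sup>2))\<^sup>2"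
          unfolding power_divide by (rule integral_divide)
        also have "\<dots> \<le> K * real (k\<^sup>2) / (real (k\<^sup>2))\<^sup>2"
          by (intro divide_right_mono K) auto
        also have "\<dots> = K * (1 / real k ^ 2)"
          by (cases "k = 0") (auto simp: field_simps power2_eq_square)
        finally show ?thesis .
      qed
      show "summable (\<lambda>k. K * (1 / real k ^ 2))"
        using inverse_power_summable[of 2, where 'a = real]
        by (intro summable_mult) (simp add: inverse_eq_divide)
    qed simp
  qed
  then have "AE x in lborel. \<forall>R::nat. x \<in> {-real R..real R} \<longrightarrow> (\<lambda>k. (S (k\<^sup>2) x / real (k\<^sup>2))\<^sup>2) \<longlonglongrightarrow> 0"
    by (simp only: AE_all_countable) blast
  then show ?thesis
  proof eventually_elim
    case (elim x)
    obtain R :: nat where "\<bar>x\<bar> \<le> real R"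
      using real_arch_simple by blast
    then have "(\<lambda>k. (S (k\<^sup>2) x / real (k\<^sup>2))\<^sup>2) \<longlonglongrightarrow> 0"
      using elim[rule_format, of R] by (simp add: abs_le_iff minus_le_iff)
    then have "(\<lambda>k. S (k\<^sup>2) x / real (k\<^sup>2)) \<longlonglongrightarrow> 0"
      using tendsto_real_sqrt by (fastforce simp: tendsto_rabs_zero_iff)
    then show ?case
      by (rule averages_tendsto_zero_along_squares[where B = B, rotated]) (rule step)
  qed
qed

section \<open>Decay of correlations between dilates\<close>

text \<open>Integrating the faster factor h(\<alpha>^n x) gains \<alpha>^(-n), while differentiating
  the slower factor h(\<alpha>^m x) costs only \<alpha>^m.\<close>

lemma dilation_correlation_bound:
  fixes h h' H :: "real \<Rightarrow> real"
  assumes H: "\<And>x. (H has_real_derivative h x) (at x)"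
    and h: "\<And>x. (h has_real_derivative h' x) (at x)"
    and h'c: "continuous_on UNIV h'"
    and B: "\<And>x. \<bar>h x\<bar> \<le> B" and B': "\<And>x. \<bar>h' x\<bar> \<le> B'" and C: "\<And>x. \<bar>H x\<bar> \<le> C"
    and "1 < \<bar>\<alpha>\<bar>" "m \<le> n" "0 \<le> R"
  shows "\<bar>integral {-R..R} (\<lambda>x. h (\<alpha> ^ m * x) * h (\<alpha> ^ n * x))\<bar>
           \<le> (2 * B * C + 2 * R * B' * C) * (1 / \<bar>\<alpha>\<bar>) ^ (n - m)"
proof -
  have \<alpha>: "\<alpha> \<noteq> 0"
    using assms by auto
  have nn: "0 \<le> B" "0 \<le> B'" "0 \<le> C"
    using B[of 0] B'[of 0] C[of 0] by linarith+
  \<comment> \<open>Integration by parts in the form P' = p + q: \<open>p\<close> is the integrand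
    to estimate, \<open>P\<close> supplies the boundary terms and \<open>q\<close> the remaining
    integral.\<close>
  define P where "P x = h (\<alpha> ^ m * x) * H (\<alpha> ^ n * x) / \<alpha> ^ n" for x
  define q where "q x = \<alpha> ^ m / \<alpha> ^ n * h' (\<alpha> ^ m * x) * H (\<alpha> ^ n * x)" for x
  define p where "p x = h (\<alpha> ^ m * x) * h (\<alpha> ^ n * x)" for x
  have hc: "continuous_on UNIV h" and Hc: "continuous_on UNIV H"
    using h H by (auto intro!: DERIV_continuous_on)
  have comp: "continuous_on {-R..R} (\<lambda>x. u (c * x))" if "continuous_on UNIV u" for u :: "real \<Rightarrow> real" and c
    by (rule continuous_on_compose2[OF that]) (auto intro!: continuous_intros)
  have qc: "continuous_on {-R..R} q" and pc: "continuous_on {-R..R} p"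
    unfolding p_def q_def divide_inverse by (intro continuous_intros comp h'c hc Hc)+
  note pi = integrable_continuous_real[OF pc] and qi = integrable_continuous_real[OF qc]
  have "(P has_real_derivative p x + q x) (at x)" for x
    unfolding P_def p_def q_def
    using \<alpha>
    by (auto intro!: derivative_eq_intros DERIV_chain'[of _ _ _ _ h] DERIV_chain'[of _ _ _ _ H] h H
             simp: field_simps)
  then have "((\<lambda>x. p x + q x) has_integral P R - P (-R)) {-R..R}"
    using \<open>0 \<le> R\<close>
    by (intro fundamental_theorem_of_calculus)
       (auto simp: has_real_derivative_iff_has_vector_derivative[symmetric] intro: DERIV_subset)
  then have "integral {-R..R} p = P R - P (-R) - integral {-R..R} q"
    using integral_add[OF pi qi] by (simp add: integral_unique)
  moreover have "\<bar>P x\<bar> \<le> B * C * (1 / \<bar>\<alpha>\<bar>) ^ (n - m)" for x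
  proof -
    have "\<bar>P x\<bar> = \<bar>h (\<alpha> ^ m * x)\<bar> * \<bar>H (\<alpha> ^ n * x)\<bar> * (1 / \<bar>\<alpha>\<bar>) ^ n"
      by (simp add: P_def abs_mult power_abs power_divide)
    \<comment> \<open>The exponent n is weakened to n - m so that boundary terms and remaining
      integral share one factor.\<close>
    also have "\<dots> \<le> B * C * (1 / \<bar>\<alpha>\<bar>) ^ (n - m)"
      using nn assms by (intro mult_mono B C power_decreasing mult_nonneg_nonneg) auto
    finally show ?thesis .
  qed
  moreover have "\<bar>integral {-R..R} q\<bar> \<le> (B' * C * (1 / \<bar>\<alpha>\<bar>) ^ (n - m)) * (R - (-R))"
  proof -
    have "norm (q x) \<le> B' * C * (1 / \<bar>\<alpha>\<bar>) ^ (n - m)" for x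
    proof -
      have "norm (q x) = \<bar>h' (\<alpha> ^ m * x)\<bar> * \<bar>H (\<alpha> ^ n * x)\<bar> * (1 / \<bar>\<alpha>\<bar>) ^ (n - m)"
        using \<open>m \<le> n\<close> \<alpha> by (simp add: q_def abs_mult power_abs power_divide power_diff)
      also have "\<dots> \<le> B' * C * (1 / \<bar>\<alpha>\<bar>) ^ (n - m)"
        using nn by (intro mult_right_mono mult_mono B' C) auto
      finally show ?thesis .
    qed
    then show ?thesis
      using integral_bound[of "-R" R q] qc \<open>0 \<le> R\<close> by simp
  qed
  ultimately have "\<bar>integral {-R..R} p\<bar>
      \<le> 2 * (B * C * (1 / \<bar>\<alpha>\<bar>) ^ (n - m)) + (B' * C * (1 / \<bar>\<alpha>\<bar>) ^ (n - m)) * (R - (-R))"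
    by (smt (verit))
  then show ?thesis
    unfolding p_def by (simp add: algebra_simps)
qed

text \<open>Expanding the square, a new summand adds its own second moment, at most
  \<open>K\<close>, and twice its correlation with the earlier sum. A geometric series bounds that
  correlation by K / (1 - r), independently of \<open>N\<close>.\<close>

lemma dilation_sum_second_moment:
  fixes h :: "real \<Rightarrow> real"
  assumes hc: "continuous_on UNIV h"
    and corr: "\<And>m n. m \<le> n \<Longrightarrow>
      \<bar>integral {-R..R} (\<lambda>x. h (\<alpha> ^ m * x) * h (\<alpha> ^ n * x))\<bar> \<le> K * r ^ (n - m)"
    and r: "0 \<le> r" "r < 1"
  shows "integral {-R..R} (\<lambda>x. (\<Sum>n<N. h (\<alpha> ^ n * x))\<^sup>2) \<le> (2 * K / (1 - r) + K) * real N"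
proof (induction N)
  case (Suc N)
  define T where "T x = (\<Sum>n<N. h (\<alpha> ^ n * x))" for x
  have K0: "0 \<le> K"
    using corr[of 0 0] by simp
  have comp: "continuous_on {-R..R} (\<lambda>x. h (c * x))" for c
    by (rule continuous_on_compose2[OF hc]) (auto intro!: continuous_intros)
  have Tc: "continuous_on {-R..R} T"
    unfolding T_def by (intro continuous_intros comp)
  have "\<bar>integral {-R..R} (\<lambda>x. T x * h (\<alpha> ^ N * x))\<bar> \<le> K / (1 - r)"
  proof -
    have "integral {-R..R} (\<lambda>x. T x * h (\<alpha> ^ N * x))
        = (\<Sum>n<N. integral {-R..R} (\<lambda>x. h (\<alpha> ^ n * x) * h (\<alpha> ^ N * x)))"
      unfolding T_def sum_distrib_right
      by (intro integral_sum integrable_continuous_real continuous_intros comp) simp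
    also have "\<bar>\<dots>\<bar> \<le> (\<Sum>n<N. K * r ^ (N - n))"
      by (rule order_trans[OF sum_abs]) (intro sum_mono corr, simp)
    \<comment> \<open>Giving up one factor \<open>r\<close> makes the exponents run exactly through
      0, ..., N - 1, ready for reversal of the sum.\<close>
    also have "\<dots> \<le> (\<Sum>n<N. K * r ^ (N - Suc n))"
      using r K0 by (intro sum_mono mult_left_mono power_decreasing) auto
    also have "\<dots> = K * (\<Sum>n<N. r ^ n)"
      by (simp add: sum_distrib_left[symmetric] sum.nat_diff_reindex)
    also have "\<dots> = K * ((1 - r ^ N) / (1 - r))"
      using r by (simp add: sum_gp_strict)
    also have "\<dots> \<le> K * (1 / (1 - r))"
      using r K0 by (intro mult_left_mono divide_right_mono) auto
    finally show ?thesis by simp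
  qed
  moreover have "\<bar>integral {-R..R} (\<lambda>x. h (\<alpha> ^ N * x) * h (\<alpha> ^ N * x))\<bar> \<le> K"
    using corr[of N N] by simp
  moreover have "integral {-R..R} (\<lambda>x. (\<Sum>n<Suc N. h (\<alpha> ^ n * x))\<^sup>2)
     = integral {-R..R} (\<lambda>x. (T x)\<^sup>2 + 2 * (T x * h (\<alpha> ^ N * x)) + h (\<alpha> ^ N * x) * h (\<alpha> ^ N * x))"
    by (simp add: T_def power2_eq_square algebra_simps)
  moreover have "\<dots> = integral {-R..R} (\<lambda>x. (T x)\<^sup>2)
      + 2 * integral {-R..R} (\<lambda>x. T x * h (\<alpha> ^ N * x))
      + integral {-R..R} (\<lambda>x. h (\<alpha> ^ N * x) * h (\<alpha> ^ N * x))"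
    by (subst integral_add integral_mult_right
          | intro integrable_continuous_real continuous_intros comp Tc)+ simp
  moreover have "(2 * K / (1 - r) + K) * real (Suc N) = (2 * K / (1 - r) + K) * real N + 2 * (K / (1 - r)) + K"
    by (simp add: algebra_simps add_divide_distrib)
  ultimately show ?case
    using Suc.IH[folded T_def] by linarith
qed simp

lemma AE_dilation_averages_tendsto_zero:
  fixes h h' H :: "real \<Rightarrow> real"
  assumes H: "\<And>x. (H has_real_derivative h x) (at x)"
    and h: "\<And>x. (h has_real_derivative h' x) (at x)"
    and h'c: "continuous_on UNIV h'"
    and B: "\<And>x. \<bar>h x\<bar> \<le> B" and B': "\<And>x. \<bar>h' x\<bar> \<le> B'" and C: "\<And>x. \<bar>H x\<bar> \<le> C"
    and \<alpha>: "1 < \<bar>\<alpha>\<bar>"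
  shows "AE x in lborel. (\<lambda>N. (\<Sum>n<N. h (\<alpha> ^ n * x)) / real N) \<longlonglongrightarrow> 0"
proof (rule AE_averages_tendsto_zero)
  have hc: "continuous_on UNIV h"
    using h by (auto intro!: DERIV_continuous_on)
  show "continuous_on UNIV (\<lambda>x. \<Sum>n<N. h (\<alpha> ^ n * x))" for N
    by (intro continuous_intros continuous_on_compose2[OF hc]) auto
  show "\<bar>(\<Sum>n<Suc N. h (\<alpha> ^ n * x)) - (\<Sum>n<N. h (\<alpha> ^ n * x))\<bar> \<le> B" for N x
    using B by simp
  show "\<exists>K. \<forall>N. integral {-R..R} (\<lambda>x. (\<Sum>n<N. h (\<alpha> ^ n * x))\<^sup>2) \<le> K * real N" if "0 \<le> R" for R
    \<comment> \<open>The ratio is 1 / |\<alpha>|; the resulting constant depends on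
      \<open>R\<close> but not on \<open>N\<close>.\<close>
    using dilation_sum_second_moment[OF hc dilation_correlation_bound[OF H h h'c B B' C \<alpha> _ that]] \<alpha>
    by fastforce
qed

section \<open>Window means as difference quotients of antiderivatives\<close>

lemma norm_increment_le:
  fixes G :: "real \<Rightarrow> 'a::real_normed_vector"
  assumes G: "\<And>x. (G has_vector_derivative g x) (at x)"
    and "a \<le> b" and le: "\<And>y. y \<in> {a..b} \<Longrightarrow> norm (g y) \<le> e"
  shows "norm (G b - G a) \<le> e * (b - a)"
proof -
  have "norm (G b - G a) \<le> e * norm (b - a)"
  proof (rule differentiable_bound)
    show "(G has_derivative (\<lambda>h. h *\<^sub>R g x)) (at x within {a..b})" for x
      using G[of x] by (simp add: has_vector_derivative_def has_derivative_at_withinI)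
    show "onorm (\<lambda>h. h *\<^sub>R g y) \<le> e" if "y \<in> {a..b}" for y
      using le[OF that] by (intro onorm_le) (simp add: mult.commute[of "\<bar>_\<bar>"] mult_right_mono)
  qed (use \<open>a \<le> b\<close> in auto)
  then show ?thesis
    using \<open>a \<le> b\<close> by simp
qed

text \<open>For an antiderivative \<open>F\<close> of \<open>f\<close>, the value \<open>diff_quot F T x\<close> is the mean of \<open>f\<close> over
  \<open>[x, x + T]\<close>.\<close>

definition diff_quot :: "(real \<Rightarrow> 'a::real_normed_vector) \<Rightarrow> real \<Rightarrow> real \<Rightarrow> 'a" where
  "diff_quot G T x = (G (x + T) - G x) /\<^sub>R T"

text \<open>Takes the place of Fubini: iterated window means of f are second differences of a second
  antiderivative, where the order is immaterial.\<close>

lemma diff_quot_commute: "diff_quot (diff_quot G S) T = diff_quot (diff_quot G T) S"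
  by (rule ext) (simp add: diff_quot_def algebra_simps)

lemma has_vector_derivative_shift:
  assumes "\<And>x. (G has_vector_derivative g x) (at x)"
  shows "((\<lambda>x. G (x + T)) has_vector_derivative g (x + T)) (at x)"
proof -
  have "((\<lambda>x. x + T) has_vector_derivative 1) (at x)"
    by (auto intro!: derivative_eq_intros)
  from vector_diff_chain_at[OF this assms] show ?thesis
    by (simp add: o_def)
qed

lemma has_vector_derivative_diff_quot:
  assumes "\<And>x. (G has_vector_derivative g x) (at x)"
  shows "(diff_quot G T has_vector_derivative diff_quot g T x) (at x)"
  unfolding diff_quot_def
  by (intro bounded_linear.has_vector_derivative[OF bounded_linear_scaleR_right]
      has_vector_derivative_diff has_vector_derivative_shift assms)

text \<open>Subtracting the linear function x c from \<open>G\<close> turns the derivative into g -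
  c, so the mean value inequality applies. It shows that a mean stays in any closed ball containing
  the averaged values.\<close>

lemma norm_diff_quot_minus_le:
  fixes G :: "real \<Rightarrow> 'a::real_normed_vector"
  assumes G: "\<And>x. (G has_vector_derivative g x) (at x)"
    and "0 < T" and le: "\<And>y. y \<in> {x..x + T} \<Longrightarrow> norm (g y - c) \<le> e"
  shows "norm (diff_quot G T x - c) \<le> e"
proof -
  have "((\<lambda>x. G x - x *\<^sub>R c) has_vector_derivative g x - c) (at x)" for x
    by (rule derivative_eq_intros G refl | simp)+
  then have "norm ((G (x + T) - (x + T) *\<^sub>R c) - (G x - x *\<^sub>R c)) \<le> e * (x + T - x)"
    using \<open>0 < T\<close> by (intro norm_increment_le[where g = "\<lambda>y. g y - c"] le) auto
  moreover have "(G (x + T) - (x + T) *\<^sub>R c) - (G x - x *\<^sub>R c) = T *\<^sub>R (diff_quot G T x - c)"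
    using \<open>0 < T\<close> by (simp add: diff_quot_def algebra_simps)
  ultimately show ?thesis
    using \<open>0 < T\<close> by (simp add: mult.commute)
qed

lemma continuous_antiderivative:
  fixes f :: "real \<Rightarrow> 'a::euclidean_space"
  assumes "continuous_on UNIV f"
  obtains F where "\<And>x. (F has_vector_derivative f x) (at x)"
  using einterval_antiderivative[of "-\<infinity>" "\<infinity>" f] assms
  by (auto simp: continuous_on_eq_continuous_at)

section \<open>Boundedness and uniform continuity of almost periodic functions\<close>

lemma bohr_almost_periodic_translation:
  assumes "bohr_almost_periodic f" "0 < \<epsilon>"
  obtains L where "0 < L" "\<And>a. \<exists>t\<in>{a..a + L}. \<forall>x. cmod (f x - f (x - t)) < \<epsilon>"
proof -
  obtain L where "0 < L" and
    L: "\<And>a. {t. (SUP x. ereal (cmod (f x - f (x - t)))) < ereal \<epsilon>} \<inter> {a..a + L} \<noteq> {}"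
    using assms unfolding bohr_almost_periodic_def relatively_dense_def by blast
  have "\<exists>t\<in>{a..a + L}. \<forall>x. cmod (f x - f (x - t)) < \<epsilon>" for a
  proof -
    obtain t where t: "t \<in> {a..a + L}" "(SUP x. ereal (cmod (f x - f (x - t)))) < ereal \<epsilon>"
      using L[of a] by blast
    have "ereal (cmod (f x - f (x - t))) < ereal \<epsilon>" for x
      by (rule le_less_trans[OF SUP_upper t(2)]) simp
    then show ?thesis
      using t(1) by (auto intro!: bexI[of _ t])
  qed
  with \<open>0 < L\<close> show ?thesis
    by (rule that)
qed

text \<open>Some almost period t in [x - L, x] carries x into the compact interval [0, L] and
  changes the value by less than 1.\<close>

lemma bohr_almost_periodic_bounded:
  assumes "bohr_almost_periodic f"
  obtains C where "0 < C" "\<And>x. cmod (f x) \<le> C"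
proof -
  obtain L where L: "\<And>a. \<exists>t\<in>{a..a + L}. \<forall>x. cmod (f x - f (x - t)) < 1"
    using bohr_almost_periodic_translation[OF assms zero_less_one] by metis
  have "bounded (f ` {0..L})"
    using assms unfolding bohr_almost_periodic_def
    by (intro compact_imp_bounded compact_continuous_image) (auto intro: continuous_on_subset)
  then obtain C where C: "0 < C" "\<And>y. y \<in> {0..L} \<Longrightarrow> cmod (f y) \<le> C"
    unfolding bounded_pos by blast
  have "cmod (f x) \<le> C + 1" for x
  proof -
    obtain t where t: "t \<in> {x - L..x - L + L}" "cmod (f x - f (x - t)) < 1"
      using L[of "x - L"] by blast
    then show ?thesis
      using C(2)[of "x - t"] norm_triangle_sub[of "f x" "f (x - t)"] by simp
  qed
  then show ?thesis
    using C(1) by (intro that[of "C + 1"]) auto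
qed

text \<open>One almost period moves both points into a fixed compact interval, where Heine-Cantor
  applies. The margin 1 at each end leaves room for the second point.\<close>

lemma bohr_almost_periodic_uniformly_continuous:
  assumes "bohr_almost_periodic f"
  shows "uniformly_continuous_on UNIV f"
  unfolding uniformly_continuous_on_def
proof (intro allI impI)
  fix e :: real assume "0 < e"
  then have "0 < e / 3" by simp
  then obtain L where "0 < L" and L: "\<And>a. \<exists>t\<in>{a..a + L}. \<forall>x. cmod (f x - f (x - t)) < e / 3"
    using bohr_almost_periodic_translation[OF assms] by blast
  have "uniformly_continuous_on {-1..L + 1} f"
    using assms unfolding bohr_almost_periodic_def
    by (intro compact_uniformly_continuous) (auto intro: continuous_on_subset)
  then obtain d where "0 < d"
    and d: "\<And>u v. u \<in> {-1..L + 1} \<Longrightarrow> v \<in> {-1..L + 1} \<Longrightarrow> dist v u < d \<Longrightarrow> dist (f v) (f u) < e / 3"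
    unfolding uniformly_continuous_on_def using \<open>0 < e / 3\<close> by blast
  have "dist (f y) (f x) < e" if "dist y x < min d 1" for x y
  proof -
    obtain t where t: "t \<in> {x - L..x - L + L}" "\<And>z. cmod (f z - f (z - t)) < e / 3"
      using L[of "x - L"] by blast
    have "dist (f (y - t)) (f (x - t)) < e / 3"
      using t(1) that by (intro d) (auto simp: dist_real_def)
    then show ?thesis
      using t(2)[of x] t(2)[of y] unfolding dist_norm by norm
  qed
  with \<open>0 < d\<close> show "\<exists>d>0. \<forall>x\<in>UNIV. \<forall>x'\<in>UNIV. dist x' x < d \<longrightarrow> dist (f x') (f x) < e"
    by (intro exI[of _ "min d 1"]) auto
qed

section \<open>Uniform existence of the mean\<close>

text \<open>An almost period t brings a + t within L of b at a cost of \<epsilon>/2. The windows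
  starting at a + t and b then differ only by end pieces of length at most L, which contribute at
  most 2CL/T to the means.\<close>

lemma bohr_almost_periodic_oscillation:
  assumes ap: "bohr_almost_periodic f"
    and F: "\<And>x. (F has_vector_derivative f x) (at x)" and "0 < \<epsilon>"
  obtains T\<^sub>0 where "0 < T\<^sub>0" "\<And>T a b. T\<^sub>0 \<le> T \<Longrightarrow> cmod (diff_quot F T a - diff_quot F T b) \<le> \<epsilon>"
proof -
  obtain C where "0 < C" and C: "\<And>x. cmod (f x) \<le> C"
    using bohr_almost_periodic_bounded[OF ap] by blast
  obtain L where "0 < L" and L: "\<And>a. \<exists>t\<in>{a..a + L}. \<forall>x. cmod (f x - f (x - t)) < \<epsilon> / 2"
    using bohr_almost_periodic_translation[OF ap half_gt_zero[OF \<open>0 < \<epsilon>\<close>]] by blast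
  show thesis
  proof (rule that)
    \<comment> \<open>This threshold is equivalent to 2CL/T \<le> \<epsilon>/2.\<close>
    show "0 < 4 * C * L / \<epsilon>"
      using \<open>0 < C\<close> \<open>0 < L\<close> \<open>0 < \<epsilon>\<close> by simp
    fix T a b :: real
    assume T: "4 * C * L / \<epsilon> \<le> T"
    with \<open>0 < 4 * C * L / \<epsilon>\<close> have "0 < T"
      by linarith
    obtain t where t: "t \<in> {b - a..b - a + L}" "\<And>x. cmod (f x - f (x - t)) < \<epsilon> / 2"
      using L[of "b - a"] by blast
    have "cmod (diff_quot (\<lambda>x. F (x + t) - F x) T a - 0) \<le> \<epsilon> / 2"
    proof (rule norm_diff_quot_minus_le)
      show "((\<lambda>x. F (x + t) - F x) has_vector_derivative f (x + t) - f x) (at x)" for x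
        by (intro has_vector_derivative_diff has_vector_derivative_shift F)
      show "cmod (f (y + t) - f y - 0) \<le> \<epsilon> / 2" for y
        using t(2)[of "y + t"] by simp
    qed fact
    then have "cmod (diff_quot F T (a + t) - diff_quot F T a) \<le> \<epsilon> / 2"
      by (simp add: diff_quot_def algebra_simps)
    moreover have "cmod (diff_quot F T (a + t) - diff_quot F T b) \<le> \<epsilon> / 2"
    proof -
      \<comment> \<open>The two end pieces are the cases z = 0 and z = T.\<close>
      have incr: "cmod (F (a + t + z) - F (b + z)) \<le> C * L" for z
      proof -
        have "cmod (F (a + t + z) - F (b + z)) \<le> C * (a + t + z - (b + z))"
          using t(1) by (intro norm_increment_le[OF F] C) auto
        also have "\<dots> \<le> C * L"
          using t(1) \<open>0 < C\<close> by (intro mult_left_mono) auto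
        finally show ?thesis .
      qed
      have "diff_quot F T (a + t) - diff_quot F T b
          = ((F (a + t + T) - F (b + T)) - (F (a + t + 0) - F (b + 0))) /\<^sub>R T"
        by (simp add: diff_quot_def algebra_simps)
      also have "cmod \<dots> \<le> (C * L + C * L) / T"
        using order_trans[OF norm_triangle_ineq4 add_mono[OF incr[of T] incr[of 0]]] \<open>0 < T\<close>
        by (simp add: divide_right_mono divide_inverse_commute)
      also have "\<dots> \<le> \<epsilon> / 2"
        using T \<open>0 < T\<close> \<open>0 < \<epsilon>\<close> by (simp add: field_simps)
      finally show ?thesis .
    qed
    ultimately show "cmod (diff_quot F T a - diff_quot F T b) \<le> \<epsilon>"
      by norm
  qed
qed

text \<open>Averaging over windows of length \<open>S\<close> and then \<open>T\<close> commutes. By the oscillation bound, each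
  of the two orders stays close to the average that is taken first.\<close>

lemma bohr_almost_periodic_diff_quot_Cauchy:
  assumes ap: "bohr_almost_periodic f"
    and F: "\<And>x. (F has_vector_derivative f x) (at x)" and "0 < \<epsilon>"
  obtains T\<^sub>0 where "0 < T\<^sub>0"
    "\<And>S T a b. T\<^sub>0 \<le> S \<Longrightarrow> T\<^sub>0 \<le> T \<Longrightarrow> cmod (diff_quot F S a - diff_quot F T b) \<le> \<epsilon>"
proof -
  obtain T\<^sub>0 where "0 < T\<^sub>0"
    and T0: "\<And>T a b. T\<^sub>0 \<le> T \<Longrightarrow> cmod (diff_quot F T a - diff_quot F T b) \<le> \<epsilon> / 2"
    using bohr_almost_periodic_oscillation[OF ap F half_gt_zero[OF \<open>0 < \<epsilon>\<close>]] by blast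
  have "continuous_on UNIV F"
    using has_vector_derivative_continuous[OF F] by (simp add: continuous_at_imp_continuous_on)
  then obtain F\<^sub>2 where F2: "\<And>x. (F\<^sub>2 has_vector_derivative F x) (at x)"
    using continuous_antiderivative by blast
  \<comment> \<open>\<open>diff_quot F\<^sub>2 S\<close> is an antiderivative of
    \<open>diff_quot F S\<close>, so the iterated quotient averages the S-means over [0, T]. All of
    these are within \<epsilon>/2 of the one at \<open>a\<close>.\<close>
  have avg: "cmod (diff_quot (diff_quot F\<^sub>2 S) T 0 - diff_quot F S a) \<le> \<epsilon> / 2" if "T\<^sub>0 \<le> S" "T\<^sub>0 \<le> T" for S T a
    using that \<open>0 < T\<^sub>0\<close>
    by (intro norm_diff_quot_minus_le[OF has_vector_derivative_diff_quot[OF F2]] T0) auto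
  have "cmod (diff_quot F S a - diff_quot F T b) \<le> \<epsilon>" if "T\<^sub>0 \<le> S" "T\<^sub>0 \<le> T" for S T a b
    using avg[OF that, of a] avg[OF that(2,1), of b] unfolding diff_quot_commute[of F\<^sub>2 T S] by norm
  with \<open>0 < T\<^sub>0\<close> show thesis
    by (rule that)
qed

text \<open>Integer window lengths at base point 0 yield a limit \<open>M\<close>. Letting one
  window grow in the Cauchy estimate gives uniform convergence to \<open>M\<close>, and a window
  centred at a is one of length 2T starting at a - T.\<close>

lemma bohr_mean_uniform_limit:
  assumes ap: "bohr_almost_periodic f"
    and F: "\<And>x. (F has_vector_derivative f x) (at x)" and "0 < \<epsilon>"
  shows "\<exists>T\<^sub>0>0. \<forall>T\<ge>T\<^sub>0. \<forall>a. cmod (diff_quot F T a - bohr_mean f) \<le> \<epsilon>"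
proof -
  have "Cauchy (\<lambda>n. diff_quot F (real n) 0)"
  proof (rule CauchyI)
    fix e :: real assume "0 < e"
    obtain T\<^sub>0 where "0 < T\<^sub>0" and T0:
      "\<And>S T a b. T\<^sub>0 \<le> S \<Longrightarrow> T\<^sub>0 \<le> T \<Longrightarrow> cmod (diff_quot F S a - diff_quot F T b) \<le> e / 2"
      using bohr_almost_periodic_diff_quot_Cauchy[OF ap F half_gt_zero[OF \<open>0 < e\<close>]] by blast
    obtain M where "T\<^sub>0 \<le> real M"
      using real_arch_simple by blast
    then have "cmod (diff_quot F (real m) 0 - diff_quot F (real n) 0) < e" if "M \<le> m" "M \<le> n" for m n
      using T0[of "real m" "real n" 0 0] that \<open>0 < e\<close> by simp
    then show "\<exists>M. \<forall>m\<ge>M. \<forall>n\<ge>M. cmod (diff_quot F (real m) 0 - diff_quot F (real n) 0) < e"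
      by blast
  qed
  then obtain M where M: "(\<lambda>n. diff_quot F (real n) 0) \<longlonglongrightarrow> M"
    using Cauchy_convergent convergent_def by blast
  have unif: "\<exists>T\<^sub>0>0. \<forall>T\<ge>T\<^sub>0. \<forall>a. cmod (diff_quot F T a - M) \<le> e" if "0 < e" for e
  proof -
    obtain T\<^sub>0 where "0 < T\<^sub>0" and T0:
      "\<And>S T a b. T\<^sub>0 \<le> S \<Longrightarrow> T\<^sub>0 \<le> T \<Longrightarrow> cmod (diff_quot F S a - diff_quot F T b) \<le> e"
      using bohr_almost_periodic_diff_quot_Cauchy[OF ap F \<open>0 < e\<close>] by blast
    have "cmod (diff_quot F T a - M) \<le> e" if "T\<^sub>0 \<le> T" for T a
    proof (rule Lim_norm_ubound)
      show "(\<lambda>n. diff_quot F T a - diff_quot F (real n) 0) \<longlonglongrightarrow> diff_quot F T a - M"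
        by (intro tendsto_intros M)
      show "\<forall>\<^sub>F n in sequentially. cmod (diff_quot F T a - diff_quot F (real n) 0) \<le> e"
        using eventually_ge_at_top[of "nat \<lceil>T\<^sub>0\<rceil>"] by eventually_elim (use that in \<open>auto intro!: T0\<close>)
    qed simp
    with \<open>0 < T\<^sub>0\<close> show ?thesis by blast
  qed
  have lim: "((\<lambda>T. (1 / (2 * T)) *\<^sub>R integral {a - T..a + T} f) \<longlongrightarrow> M) at_top" for a
  proof (rule tendstoI)
    fix e :: real assume "0 < e"
    obtain T\<^sub>0 where "0 < T\<^sub>0" and T0: "\<And>T a. T\<^sub>0 \<le> T \<Longrightarrow> cmod (diff_quot F T a - M) \<le> e / 2"
      using unif[OF half_gt_zero[OF \<open>0 < e\<close>]] by blast
    show "\<forall>\<^sub>F T in at_top. dist ((1 / (2 * T)) *\<^sub>R integral {a - T..a + T} f) M < e"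
      using eventually_ge_at_top[of T\<^sub>0]
    proof eventually_elim
      case (elim T)
      with \<open>0 < T\<^sub>0\<close> have "(f has_integral F (a + T) - F (a - T)) {a - T..a + T}"
        by (intro fundamental_theorem_of_calculus[OF _ has_vector_derivative_at_within[OF F]]) simp
      then have "(1 / (2 * T)) *\<^sub>R integral {a - T..a + T} f = diff_quot F (2 * T) (a - T)"
        by (simp add: integral_unique diff_quot_def inverse_eq_divide add.commute)
      then show ?case
        using T0[of "2 * T" "a - T"] elim \<open>0 < T\<^sub>0\<close> \<open>0 < e\<close> by (simp add: dist_norm)
    qed
  qed
  \<comment> \<open>The definite description is resolved by \<open>lim\<close> together with
    uniqueness of limits.\<close>
  have "bohr_mean f = M"
    unfolding bohr_mean_def
    using lim by (intro the_equality) (auto intro: tendsto_unique[OF trivial_limit_at_top_linorder])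
  then show ?thesis
    using unif[OF \<open>0 < \<epsilon>\<close>] by simp
qed

section \<open>Smooth approximation and conclusion\<close>

text \<open>Subtracting a long window mean instead of the constant M(f) secures a bounded
  antiderivative; one of f - M(f) itself may be unbounded.\<close>

lemma bohr_almost_periodic_smooth_approximation:
  assumes ap: "bohr_almost_periodic f" and "0 < \<epsilon>"
  obtains h h' H :: "real \<Rightarrow> complex" and B
  where "\<And>x. (H has_vector_derivative h x) (at x)"
    and "\<And>x. (h has_vector_derivative h' x) (at x)" and "continuous_on UNIV h'"
    and "\<And>x. cmod (h x) \<le> B" and "\<And>x. cmod (h' x) \<le> B" and "\<And>x. cmod (H x) \<le> B"
    and "\<And>x. cmod (f x - bohr_mean f - h x) \<le> \<epsilon>"
proof -
  have fc: "continuous_on UNIV f"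
    using ap by (simp add: bohr_almost_periodic_def)
  then obtain F where F: "\<And>x. (F has_vector_derivative f x) (at x)"
    using continuous_antiderivative by blast
  have "continuous_on UNIV F"
    using has_vector_derivative_continuous[OF F] by (simp add: continuous_at_imp_continuous_on)
  then obtain F\<^sub>2 where F2: "\<And>x. (F\<^sub>2 has_vector_derivative F x) (at x)"
    using continuous_antiderivative by blast
  obtain C where "0 < C" and C: "\<And>x. cmod (f x) \<le> C"
    using bohr_almost_periodic_bounded[OF ap] by blast
  obtain d\<^sub>0 where "0 < d\<^sub>0" and d0: "\<And>x y. dist y x < d\<^sub>0 \<Longrightarrow> dist (f y) (f x) < \<epsilon> / 2"
    using bohr_almost_periodic_uniformly_continuous[OF ap] half_gt_zero[OF \<open>0 < \<epsilon>\<close>]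
    unfolding uniformly_continuous_on_def by blast
  \<comment> \<open>Halving keeps the closed window [x, x + d] strictly within distance
    \<open>d\<^sub>0\<close> of x.\<close>
  define d where "d = d\<^sub>0 / 2"
  have "0 < d"
    using \<open>0 < d\<^sub>0\<close> by (simp add: d_def)
  obtain L where "0 < L" and L: "\<And>a. cmod (diff_quot F L a - bohr_mean f) \<le> \<epsilon> / 2"
    using bohr_mean_uniform_limit[OF ap F half_gt_zero[OF \<open>0 < \<epsilon>\<close>]] by (meson order_refl)
  define h where "h x = diff_quot F d x - diff_quot F L x" for x
  define h' where "h' x = diff_quot f d x - diff_quot f L x" for x
  define H where "H x = diff_quot F\<^sub>2 d x - diff_quot F\<^sub>2 L x" for x
  define B where "B = Max {2 * C, 2 * C / d + 2 * C / L, C * d + C * L}"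
  show thesis
  proof
    show "(H has_vector_derivative h x) (at x)" for x
      unfolding H_def h_def
      by (intro has_vector_derivative_diff has_vector_derivative_diff_quot F2)
    show "(h has_vector_derivative h' x) (at x)" for x
      unfolding h_def h'_def
      by (intro has_vector_derivative_diff has_vector_derivative_diff_quot F)
    show "continuous_on UNIV h'"
      unfolding h'_def diff_quot_def by (intro continuous_intros continuous_on_compose2[OF fc]) auto
    show "cmod (h x) \<le> B" for x
    proof -
      have "cmod (diff_quot F T x - 0) \<le> C" if "0 < T" for T
        using C by (intro norm_diff_quot_minus_le[OF F that]) simp
      from this[OF \<open>0 < d\<close>] this[OF \<open>0 < L\<close>] have "cmod (h x) \<le> 2 * C"
        unfolding h_def by norm
      then show ?thesis
        by (simp add: B_def)
    qed
    show "cmod (h' x) \<le> B" for x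
    proof -
      have "cmod (diff_quot f T x) \<le> 2 * C / T" if "0 < T" for T
        using order_trans[OF norm_triangle_ineq4 add_mono[OF C C], of "x + T" x] that
        by (simp add: diff_quot_def divide_right_mono divide_inverse_commute)
      from this[OF \<open>0 < d\<close>] this[OF \<open>0 < L\<close>] have "cmod (h' x) \<le> 2 * C / d + 2 * C / L"
        unfolding h'_def by (meson add_mono norm_triangle_ineq4 order_trans)
      then show ?thesis
        by (simp add: B_def)
    qed
    show "cmod (H x) \<le> B" for x
    proof -
      \<comment> \<open>Both window means of \<open>F\<close> stay near F(x), so the possibly
        unbounded F(x) cancels in their difference.\<close>
      have "cmod (diff_quot F\<^sub>2 T x - F x) \<le> C * T" if "0 < T" for T
      proof (rule norm_diff_quot_minus_le[OF F2 that])
        fix y assume y: "y \<in> {x..x + T}"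
        then have "cmod (F y - F x) \<le> C * (y - x)"
          by (intro norm_increment_le[OF F] C) auto
        also have "\<dots> \<le> C * T"
          using y \<open>0 < C\<close> by (intro mult_left_mono) auto
        finally show "cmod (F y - F x) \<le> C * T" .
      qed
      from this[OF \<open>0 < d\<close>] this[OF \<open>0 < L\<close>] have "cmod (H x) \<le> C * d + C * L"
        unfolding H_def using norm_triangle_ineq4[of "diff_quot F\<^sub>2 d x - F x" "diff_quot F\<^sub>2 L x - F x"] by simp
      then show ?thesis
        by (simp add: B_def)
    qed
    show "cmod (f x - bohr_mean f - h x) \<le> \<epsilon>" for x
    proof -
      have "cmod (diff_quot F d x - f x) \<le> \<epsilon> / 2"
      proof (rule norm_diff_quot_minus_le[OF F \<open>0 < d\<close>])
        show "cmod (f y - f x) \<le> \<epsilon> / 2" if "y \<in> {x..x + d}" for y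
          using d0[of y x] that \<open>0 < d\<^sub>0\<close> by (simp add: dist_norm d_def)
      qed
      then show ?thesis
        using L[of x] unfolding h_def by norm
    qed
  qed
qed

text \<open>The second moment argument is real, so real and imaginary parts are treated
  separately.\<close>

lemma AE_dilation_averages_tendsto_zero_complex:
  fixes h h' H :: "real \<Rightarrow> complex"
  assumes H: "\<And>x. (H has_vector_derivative h x) (at x)"
    and h: "\<And>x. (h has_vector_derivative h' x) (at x)"
    and h'c: "continuous_on UNIV h'"
    and B: "\<And>x. cmod (h x) \<le> B" "\<And>x. cmod (h' x) \<le> B" "\<And>x. cmod (H x) \<le> B"
    and \<alpha>: "1 < \<bar>\<alpha>\<bar>"
  shows "AE x in lborel. (\<lambda>N. (\<Sum>n<N. h (\<alpha> ^ n * x)) / of_nat N) \<longlonglongrightarrow> 0"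
proof -
  have "AE x in lborel. (\<lambda>N. (\<Sum>n<N. Re (h (\<alpha> ^ n * x))) / real N) \<longlonglongrightarrow> 0"
    by (rule AE_dilation_averages_tendsto_zero[where H = "\<lambda>x. Re (H x)" and h' = "\<lambda>x. Re (h' x)"])
       (auto simp: has_real_derivative_iff_has_vector_derivative \<alpha>
          intro!: bounded_linear.has_vector_derivative[OF bounded_linear_Re] H h
            continuous_intros h'c order_trans[OF abs_Re_le_cmod] B)
  moreover have "AE x in lborel. (\<lambda>N. (\<Sum>n<N. Im (h (\<alpha> ^ n * x))) / real N) \<longlonglongrightarrow> 0"
    by (rule AE_dilation_averages_tendsto_zero[where H = "\<lambda>x. Im (H x)" and h' = "\<lambda>x. Im (h' x)"])
       (auto simp: has_real_derivative_iff_has_vector_derivative \<alpha>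
          intro!: bounded_linear.has_vector_derivative[OF bounded_linear_Im] H h
            continuous_intros h'c order_trans[OF abs_Im_le_cmod] B)
  ultimately show ?thesis
    by eventually_elim (simp add: tendsto_complex_iff Re_divide_of_nat Im_divide_of_nat)
qed

theorem theorem4p4:
  fixes \<alpha> :: real and f :: "real \<Rightarrow> complex"
  assumes "\<bar>\<alpha>\<bar> > 1"
    and "bohr_almost_periodic f"
  shows "AE x in lebesgue.
           (\<lambda>N. (1 / of_nat N) * (\<Sum>n<N. f (\<alpha> ^ n * x))) \<longlonglongrightarrow> bohr_mean f"
proof -
  \<comment> \<open>The exceptional null set depends on \<open>h\<close>; tolerances 1/(k+1) keep
    the number of such sets countable.\<close>
  have "\<exists>h. (\<forall>x. cmod (f x - bohr_mean f - h x) \<le> 1 / Suc k) \<and>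
          (AE x in lborel. (\<lambda>N. (\<Sum>n<N. h (\<alpha> ^ n * x)) / of_nat N) \<longlonglongrightarrow> 0)" for k
  proof -
    have "0 < 1 / real (Suc k)" by simp
    then show ?thesis
    proof (rule bohr_almost_periodic_smooth_approximation[OF assms(2)])
      fix h h' H :: "real \<Rightarrow> complex" and B
      assume hyps: "\<And>x. (H has_vector_derivative h x) (at x)"
        "\<And>x. (h has_vector_derivative h' x) (at x)" "continuous_on UNIV h'"
        "\<And>x. cmod (h x) \<le> B" "\<And>x. cmod (h' x) \<le> B" "\<And>x. cmod (H x) \<le> B"
        and "\<And>x. cmod (f x - bohr_mean f - h x) \<le> 1 / Suc k"
      then show ?thesis
        using AE_dilation_averages_tendsto_zero_complex[OF hyps assms(1)] by blast
    qed
  qed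
  then obtain h where "\<forall>k. (\<forall>x. cmod (f x - bohr_mean f - h k x) \<le> 1 / Suc k) \<and>
      (AE x in lborel. (\<lambda>N. (\<Sum>n<N. h k (\<alpha> ^ n * x)) / of_nat N) \<longlonglongrightarrow> 0)"
    using choice[of "\<lambda>k h. (\<forall>x. cmod (f x - bohr_mean f - h x) \<le> 1 / Suc k) \<and>
      (AE x in lborel. (\<lambda>N. (\<Sum>n<N. h (\<alpha> ^ n * x)) / of_nat N) \<longlonglongrightarrow> 0)"] by blast
  then have h: "\<And>k x. cmod (f x - bohr_mean f - h k x) \<le> 1 / Suc k"
    and "\<And>k. AE x in lborel. (\<lambda>N. (\<Sum>n<N. h k (\<alpha> ^ n * x)) / of_nat N) \<longlonglongrightarrow> 0"
    by blast+
  then have "AE x in lborel. \<forall>k. (\<lambda>N. (\<Sum>n<N. h k (\<alpha> ^ n * x)) / of_nat N) \<longlonglongrightarrow> 0"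
    unfolding AE_all_countable by blast
  then have "AE x in lborel. (\<lambda>N. (1 / of_nat N) * (\<Sum>n<N. f (\<alpha> ^ n * x))) \<longlonglongrightarrow> bohr_mean f"
  proof eventually_elim
    case (elim x)
    show ?case
    proof (rule tendstoI)
      fix e :: real assume "0 < e"
      then obtain k where k: "1 / Suc k < e / 2"
        by (meson half_gt_zero nat_approx_posE)
      have "\<forall>\<^sub>F N in sequentially. dist ((\<Sum>n<N. h k (\<alpha> ^ n * x)) / of_nat N) 0 < e / 2"
        using elim \<open>0 < e\<close> by (intro tendstoD) auto
      then show "\<forall>\<^sub>F N in sequentially. dist (1 / of_nat N * (\<Sum>n<N. f (\<alpha> ^ n * x))) (bohr_mean f) < e"
        using eventually_gt_at_top[of 0]
      proof eventually_elim
        case (elim N)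
        \<comment> \<open>\<open>u\<close> averages the approximation error and \<open>v\<close>
          averages \<open>h k\<close>. Since N > 0, the constant M(f) averages to itself.\<close>
        define u where "u = (\<Sum>n<N. f (\<alpha> ^ n * x) - bohr_mean f - h k (\<alpha> ^ n * x)) / of_nat N"
        define v where "v = (\<Sum>n<N. h k (\<alpha> ^ n * x)) / of_nat N"
        have "cmod (\<Sum>n<N. f (\<alpha> ^ n * x) - bohr_mean f - h k (\<alpha> ^ n * x)) \<le> real N * (1 / Suc k)"
          using sum_norm_bound[of "{..<N}" "\<lambda>n. f (\<alpha> ^ n * x) - bohr_mean f - h k (\<alpha> ^ n * x)" "1 / Suc k"] h
          by simp
        then have "cmod u \<le> 1 / Suc k"
          using \<open>0 < N\<close> by (simp add: u_def norm_divide field_simps)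
        moreover have "cmod v < e / 2"
          using elim by (simp add: v_def)
        ultimately have "cmod (u + v) < e"
          using norm_triangle_ineq[of u v] k by linarith
        moreover have "1 / of_nat N * (\<Sum>n<N. f (\<alpha> ^ n * x)) - bohr_mean f = u + v"
          using \<open>0 < N\<close> by (simp add: u_def v_def sum_subtractf diff_divide_distrib)
        ultimately show ?case
          unfolding dist_norm by simp
      qed
    qed
  qed
  \<comment> \<open>A Borel null set is also null for the completed measure.\<close>
  then show ?thesis
    by (rule AE_completion)
qed

end
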